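(* Let $R$ be a commutative integral domain. If $R$ is weakly productively bounded, then $R$ is productively bounded.
   Context: Let $R$ be a commutative integral domain. An $R$-module $M$ is torsion if every element of $M$ is annihilated by some nonzero element of $R$. For an $R$-module $M$, $\operatorname{ann}_R(M)=\{r\in R: rM=0\}$. The intersection of an empty family of ideals is $R$. A subset $J\subseteq I$ is cofinite if $I\setminus J$ is finite. $R$ is called productively bounded if, for every family $(M_i)_{i\in I}$ of torsion $R$-modules such that the direct product $\prod_{i\in I}M_i$ is torsion, there is a cofinite subset $J\subseteq I$ with $\bigcap_{i\in J}\operatorname{ann}_R(M_i)\neq 0$. $R$ is called weakly productively bounded if, for every family $(M_i)_{i\in I}$ of $R$-modules such that $\prod_{i\in I}M_i$ is torsion, $\operatorname{ann}_R(M_i)\ne 0$ for all but finitely many $i\in I$. *)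

theory Defs
  imports "HOL-Algebra.Module" "HOL-Library.Equipollence"
begin

definition direct_product ::
    "'i set \<Rightarrow> ('i \<Rightarrow> ('a, 'm, 'z) module_scheme) \<Rightarrow> ('a, 'i \<Rightarrow> 'm) module" where
  "direct_product I M =
     \<lparr>carrier = (\<Pi>\<^sub>E i\<in>I. carrier (M i)),
      monoid.mult = (\<lambda>x y. \<lambda>i\<in>I. x i \<otimes>\<^bsub>M i\<^esub> y i),
      one = (\<lambda>i\<in>I. \<one>\<^bsub>M i\<^esub>),
      zero = (\<lambda>i\<in>I. \<zero>\<^bsub>M i\<^esub>),
      add = (\<lambda>x y. \<lambda>i\<in>I. x i \<oplus>\<^bsub>M i\<^esub> y i),
      smult = (\<lambda>r x. \<lambda>i\<in>I. r \<odot>\<^bsub>M i\<^esub> x i)\<rparr>"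

definition torsion_module ::
    "('a, 'k) ring_scheme \<Rightarrow> ('a, 'm, 'z) module_scheme \<Rightarrow> bool" where
  "torsion_module R M \<longleftrightarrow>
     (\<forall>x\<in>carrier M. \<exists>r\<in>carrier R. r \<noteq> \<zero>\<^bsub>R\<^esub> \<and> r \<odot>\<^bsub>M\<^esub> x = \<zero>\<^bsub>M\<^esub>)"

definition annihilator ::
    "('a, 'k) ring_scheme \<Rightarrow> ('a, 'm, 'z) module_scheme \<Rightarrow> 'a set" where
  "annihilator R M = {r \<in> carrier R. \<forall>x\<in>carrier M. r \<odot>\<^bsub>M\<^esub> x = \<zero>\<^bsub>M\<^esub>}"

text \<open>A predicate cannot quantify over types, so the types of the indices and of the
  module elements are parameters of the next two predicates. Intersecting with
  \<open>carrier R\<close> makes the empty intersection equal to \<open>R\<close>.\<close>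

definition productively_bounded ::
    "'i itself \<Rightarrow> 'm itself \<Rightarrow> ('a, 'k) ring_scheme \<Rightarrow> bool" where
  "productively_bounded _ _ R \<longleftrightarrow>
     (\<forall>(I :: 'i set) (M :: 'i \<Rightarrow> ('a, 'm) module).
        (\<forall>i\<in>I. module R (M i) \<and> torsion_module R (M i)) \<longrightarrow>
        torsion_module R (direct_product I M) \<longrightarrow>
        (\<exists>J\<subseteq>I. finite (I - J) \<and>
           carrier R \<inter> (\<Inter>i\<in>J. annihilator R (M i)) \<noteq> {\<zero>\<^bsub>R\<^esub>}))"

definition weakly_productively_bounded ::
    "'i itself \<Rightarrow> 'm itself \<Rightarrow> ('a, 'k) ring_scheme \<Rightarrow> bool" where
  "weakly_productively_bounded _ _ R \<longleftrightarrow>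
     (\<forall>(I :: 'i set) (M :: 'i \<Rightarrow> ('a, 'm) module).
        (\<forall>i\<in>I. module R (M i)) \<longrightarrow>
        torsion_module R (direct_product I M) \<longrightarrow>
        finite {i \<in> I. annihilator R (M i) = {\<zero>\<^bsub>R\<^esub>}})"

lemma module_direct_product:
  assumes R: "cring R" and M: "\<And>i. i \<in> I \<Longrightarrow> module R (M i)"
  shows "module R (direct_product I M)"
proof (rule moduleI)
  note ag = module.axioms(2)[OF M]
  show "abelian_group (direct_product I M)"
  proof (rule abelian_groupI, goal_cases)
    case (6 x)
    then show ?case
      by (intro bexI[of _ "\<lambda>i\<in>I. \<ominus>\<^bsub>M i\<^esub> x i"])
        (auto simp: direct_product_def PiE_iff abelian_group.l_neg[OF ag]
           abelian_group.a_inv_closed[OF ag])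
  next
    case (5 x)
    then show ?case
      by (auto simp: direct_product_def PiE_iff fun_eq_iff extensional_def
           abelian_monoid.l_zero[OF abelian_group.axioms(1)[OF ag]]
           split: if_splits)
  qed (auto simp: direct_product_def PiE_iff intro!: restrict_ext
        abelian_monoid.a_closed[OF abelian_group.axioms(1)[OF ag]]
        abelian_monoid.zero_closed[OF abelian_group.axioms(1)[OF ag]]
        abelian_monoid.a_assoc[OF abelian_group.axioms(1)[OF ag]]
        abelian_monoid.a_comm[OF abelian_group.axioms(1)[OF ag]])
next
  fix x assume "x \<in> carrier (direct_product I M)"
  then show "\<one>\<^bsub>R\<^esub> \<odot>\<^bsub>direct_product I M\<^esub> x = x"
    by (auto simp: direct_product_def PiE_iff fun_eq_iff extensional_def
         module.smult_one[OF M])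
qed (use R in \<open>auto simp: direct_product_def PiE_iff intro!: restrict_ext
      module.smult_closed[OF M] module.smult_l_distr[OF M] module.smult_r_distr[OF M]
      module.smult_assoc1[OF M]\<close>)

lemma times_lepoll_infinite:
  assumes "infinite A"
  shows "A \<times> A \<lesssim> A"
  unfolding lepoll_def card_of_ordLeq
  by (rule ordIso_imp_ordLeq[OF card_of_Times_same_infinite[OF assms]])

lemma lists_lepoll_infinite:
  assumes "infinite A"
  shows "lists A \<lesssim> A"
proof -
  have "A \<times> A \<lesssim> A" using assms by (rule times_lepoll_infinite)
  then obtain p where p: "inj_on p (A \<times> A)" "p ` (A \<times> A) \<subseteq> A"
    unfolding lepoll_def by blast
  obtain q :: "nat \<Rightarrow> 'a" where q: "inj q" "range q \<subseteq> A"
    using infinite_countable_subset[OF assms] by blast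
  define enc where "enc = rec_list (q 0) (\<lambda>x _ y. p (x, y))"
  have enc_simps: "enc [] = q 0" "enc (x # xs) = p (x, enc xs)" for x xs
    by (simp_all add: enc_def)
  have enc_in: "enc xs \<in> A" if "xs \<in> lists A" for xs
    using that
  proof induction
    case Nil
    then show ?case using q(2) by (auto simp: enc_simps)
  next
    case (Cons x xs)
    then have "p (x, enc xs) \<in> p ` (A \<times> A)" by blast
    then show ?case using p(2) by (auto simp only: enc_simps)
  qed
  have enc_inj: "xs = ys"
    if "length xs = length ys" "xs \<in> lists A" "ys \<in> lists A" "enc xs = enc ys" for xs ys
    using that
  proof (induction xs ys rule: list_induct2)
    case (Cons x xs y ys)
    then have "(x, enc xs) = (y, enc ys)"
      using enc_in by (intro inj_onD[OF p(1)]) (auto simp: enc_simps)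
    with Cons show ?case by simp
  qed simp
  define c where "c = (\<lambda>xs. p (q (length xs), enc xs))"
  have "inj_on c (lists A)"
  proof (rule inj_onI)
    fix xs ys assume xy: "xs \<in> lists A" "ys \<in> lists A" "c xs = c ys"
    then have "(q (length xs), enc xs) = (q (length ys), enc ys)"
      using enc_in q(2) by (intro inj_onD[OF p(1)]) (auto simp: c_def)
    then show "xs = ys" using enc_inj xy injD[OF q(1)] by blast
  qed
  moreover have "c ` lists A \<subseteq> A"
  proof
    fix y assume "y \<in> c ` lists A"
    then obtain xs where "xs \<in> lists A" "y = p (q (length xs), enc xs)" by (auto simp: c_def)
    then have "y \<in> p ` (A \<times> A)" using q(2) enc_in by blast
    then show "y \<in> A" using p(2) by blast
  qed
  ultimately show ?thesis unfolding lepoll_def by blast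
qed

text \<open>A module with zero annihilator has a submodule with zero annihilator that is generated
  by at most \<open>|R|\<close> elements, and hence has a copy inside the ring's own type.\<close>

lemma (in domain) faithful_submodule_copy:
  fixes M :: "('a, 'm) module"
  assumes M: "module R M" and ann: "annihilator R M = {\<zero>}" and inf: "infinite (carrier R)"
  shows "\<exists>(N :: ('a, 'a) module) \<psi>. module R N \<and> annihilator R N = {\<zero>} \<and>
           inj_on \<psi> (carrier N) \<and> \<psi> ` carrier N \<subseteq> carrier M \<and> \<psi> \<zero>\<^bsub>N\<^esub> = \<zero>\<^bsub>M\<^esub> \<and>
           (\<forall>r\<in>carrier R. \<forall>x\<in>carrier N. r \<odot>\<^bsub>N\<^esub> x \<in> carrier N \<and> \<psi> (r \<odot>\<^bsub>N\<^esub> x) = r \<odot>\<^bsub>M\<^esub> \<psi> x)"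
proof -
  interpret M: module R M by fact
  have "\<forall>s. \<exists>y. y \<in> carrier M \<and> (s \<in> carrier R \<longrightarrow> s \<noteq> \<zero> \<longrightarrow> s \<odot>\<^bsub>M\<^esub> y \<noteq> \<zero>\<^bsub>M\<^esub>)"
    using ann M.zero_closed unfolding annihilator_def by blast
  then obtain m where m: "\<And>s. m s \<in> carrier M"
    "\<And>s. s \<in> carrier R \<Longrightarrow> s \<noteq> \<zero> \<Longrightarrow> s \<odot>\<^bsub>M\<^esub> m s \<noteq> \<zero>\<^bsub>M\<^esub>" by metis
  define h where "h = rec_list \<zero>\<^bsub>M\<^esub> (\<lambda>(r, s) _ y. r \<odot>\<^bsub>M\<^esub> m s \<oplus>\<^bsub>M\<^esub> y)"
  have h_simps: "h [] = \<zero>\<^bsub>M\<^esub>" "h ((r, s) # xs) = r \<odot>\<^bsub>M\<^esub> m s \<oplus>\<^bsub>M\<^esub> h xs" for r s xs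
    by (simp_all add: h_def)
  define L where "L = lists (carrier R \<times> carrier R)"
  have h_closed: "h xs \<in> carrier M" if "xs \<in> L" for xs
    using that unfolding L_def by induction (auto simp: h_simps m)
  have h_append: "h (xs @ ys) = h xs \<oplus>\<^bsub>M\<^esub> h ys" if "xs \<in> L" "ys \<in> L" for xs ys
    using that(1) h_closed[OF that(2)] unfolding L_def
  proof induction
    case (Cons a xs)
    then show ?case using h_closed[of xs]
      by (cases a) (auto simp: h_simps m L_def M.a_assoc)
  qed (auto simp: h_simps)
  have h_smult: "h (map (\<lambda>(s, t). (r \<otimes> s, t)) xs) = r \<odot>\<^bsub>M\<^esub> h xs"
    if "xs \<in> L" "r \<in> carrier R" for r xs
    using that(1) that(2) unfolding L_def
  proof induction
    case (Cons a xs)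
    then show ?case using h_closed[of xs]
      by (cases a) (auto simp: h_simps m L_def M.smult_r_distr M.smult_assoc1)
  qed (auto simp: h_simps)
  define H where "H = h ` L"
  have sub: "H \<subseteq> carrier M" using h_closed by (auto simp: H_def)
  have zero: "\<zero>\<^bsub>M\<^esub> \<in> H" unfolding H_def L_def
    by (intro image_eqI[of _ _ "[]"]) (auto simp: h_simps)
  have smult: "r \<odot>\<^bsub>M\<^esub> x \<in> H" if r: "r \<in> carrier R" and x: "x \<in> H" for r x
  proof -
    obtain xs where xs: "xs \<in> L" "x = h xs" using x by (auto simp: H_def)
    have "map (\<lambda>(s, t). (r \<otimes> s, t)) xs \<in> L"
      using xs r unfolding L_def by (auto simp: lists_eq_set)
    then show ?thesis using h_smult[OF xs(1) r] xs(2) unfolding H_def by (metis imageI)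
  qed
  have add: "x \<oplus>\<^bsub>M\<^esub> y \<in> H" if xy: "x \<in> H" "y \<in> H" for x y
  proof -
    obtain xs ys where "xs \<in> L" "x = h xs" "ys \<in> L" "y = h ys" using xy by (auto simp: H_def)
    then show ?thesis using h_append[of xs ys] unfolding H_def L_def
      by (intro image_eqI[of _ _ "xs @ ys"]) auto
  qed
  have neg: "\<ominus>\<^bsub>M\<^esub> x \<in> H" if "x \<in> H" for x
    using smult[of "\<ominus> \<one>" x] that sub M.smult_l_minus[of \<one> x] by auto
  have mem: "m s \<in> H" if "s \<in> carrier R" for s
    unfolding H_def L_def using that
    by (intro image_eqI[of _ _ "[(\<one>, s)]"]) (auto simp: h_simps m)
  have "H \<lesssim> L" unfolding H_def by (rule image_lepoll)
  also have "L \<lesssim> lists (carrier R)" unfolding L_def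
    by (intro lists_lepoll_mono times_lepoll_infinite inf)
  also have "lists (carrier R) \<lesssim> carrier R" by (rule lists_lepoll_infinite[OF inf])
  finally obtain \<phi> :: "'m \<Rightarrow> 'a" where \<phi>: "inj_on \<phi> H" unfolding lepoll_def by blast
  define \<psi> where "\<psi> = inv_into H \<phi>"
  have \<psi>\<phi>[simp]: "\<psi> (\<phi> x) = x" if "x \<in> H" for x
    using \<phi> that by (simp add: \<psi>_def)
  define N :: "('a, 'a) module" where "N =
    \<lparr>carrier = \<phi> ` H, monoid.mult = undefined, one = undefined, zero = \<phi> \<zero>\<^bsub>M\<^esub>,
     add = (\<lambda>x y. \<phi> (\<psi> x \<oplus>\<^bsub>M\<^esub> \<psi> y)), smult = (\<lambda>r x. \<phi> (r \<odot>\<^bsub>M\<^esub> \<psi> x))\<rparr>"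
  have HM: "x \<in> carrier M" if "x \<in> H" for x using sub that by blast
  have "module R N"
  proof (rule moduleI)
    show "abelian_group N"
    proof (rule abelian_groupI, goal_cases)
      case (6 x)
      then obtain y where "y \<in> H" "x = \<phi> y" by (auto simp: N_def)
      then show ?case
        by (intro bexI[of _ "\<phi> (\<ominus>\<^bsub>M\<^esub> y)"]) (simp_all add: N_def neg HM M.l_neg)
    next
      case (4 x y)
      then show ?case by (auto simp: N_def HM intro!: arg_cong[of _ _ \<phi>] M.a_comm)
    qed (auto simp: N_def zero add HM M.a_assoc)
  next
    fix a b x assume "a \<in> carrier R" "b \<in> carrier R" "x \<in> carrier N"
    then show "(a \<oplus> b) \<odot>\<^bsub>N\<^esub> x = a \<odot>\<^bsub>N\<^esub> x \<oplus>\<^bsub>N\<^esub> b \<odot>\<^bsub>N\<^esub> x"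
      by (auto simp: N_def add smult HM M.smult_l_distr)
  next
    fix a x y assume "a \<in> carrier R" "x \<in> carrier N" "y \<in> carrier N"
    then show "a \<odot>\<^bsub>N\<^esub> (x \<oplus>\<^bsub>N\<^esub> y) = a \<odot>\<^bsub>N\<^esub> x \<oplus>\<^bsub>N\<^esub> a \<odot>\<^bsub>N\<^esub> y"
      by (auto simp: N_def add smult HM M.smult_r_distr)
  next
    fix a b x assume "a \<in> carrier R" "b \<in> carrier R" "x \<in> carrier N"
    then show "(a \<otimes> b) \<odot>\<^bsub>N\<^esub> x = a \<odot>\<^bsub>N\<^esub> (b \<odot>\<^bsub>N\<^esub> x)"
      by (auto simp: N_def smult HM M.smult_assoc1)
  qed (auto simp: N_def smult HM is_cring)
  moreover have "annihilator R N = {\<zero>}"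
  proof -
    have "r = \<zero>" if "r \<in> annihilator R N" for r
    proof (rule ccontr)
      assume "r \<noteq> \<zero>"
      moreover have r: "r \<in> carrier R" using that by (simp add: annihilator_def)
      moreover have "\<phi> (r \<odot>\<^bsub>M\<^esub> m r) = \<phi> \<zero>\<^bsub>M\<^esub>"
        using that r mem[OF r] by (auto simp: annihilator_def N_def)
      then have "r \<odot>\<^bsub>M\<^esub> m r = \<zero>\<^bsub>M\<^esub>"
        using inj_onD[OF \<phi>] smult[OF r mem[OF r]] zero by blast
      ultimately show False using m(2) by blast
    qed
    moreover have "\<zero> \<in> annihilator R N"
      by (auto simp: annihilator_def N_def HM)
    ultimately show ?thesis by blast
  qed
  moreover have "inj_on \<psi> (carrier N)" by (auto simp: N_def inj_on_def)
  moreover have "\<psi> ` carrier N \<subseteq> carrier M" by (auto simp: N_def HM)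
  ultimately show ?thesis
    by (intro exI[of _ N] exI[of _ \<psi>]) (auto simp: N_def zero smult)
qed

text \<open>Countable families of modules with elements in the ring's own type determine weak productive
  boundedness for families over arbitrary types, so \<open>TYPE(nat)\<close> and \<open>TYPE('a)\<close>
  lose no generality.\<close>

theorem (in domain) weakly_productively_bounded_any_type:
  assumes "weakly_productively_bounded TYPE(nat) TYPE('a) R"
  shows "weakly_productively_bounded TYPE('i) TYPE('m) R"
  unfolding weakly_productively_bounded_def
proof (intro allI impI)
  fix I :: "'i set" and M :: "'i \<Rightarrow> ('a, 'm) module"
  assume M: "\<forall>i\<in>I. module R (M i)" and tors: "torsion_module R (direct_product I M)"
  define B where "B = {i \<in> I. annihilator R (M i) = {\<zero>}}"
  have extend: "\<exists>r\<in>carrier R. r \<noteq> \<zero> \<and> (\<forall>i\<in>K. r \<odot>\<^bsub>M i\<^esub> x i = \<zero>\<^bsub>M i\<^esub>)"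
    if K: "K \<subseteq> I" and x: "\<And>i. i \<in> K \<Longrightarrow> x i \<in> carrier (M i)" for K x
  proof -
    define y where "y = (\<lambda>i\<in>I. if i \<in> K then x i else \<zero>\<^bsub>M i\<^esub>)"
    have "y \<in> carrier (direct_product I M)"
    proof -
      have "\<zero>\<^bsub>M i\<^esub> \<in> carrier (M i)" if "i \<in> I" for i
        using M that abelian_monoid.zero_closed abelian_group.axioms(1) module.axioms(2) by blast
      then show ?thesis using x by (simp add: y_def direct_product_def)
    qed
    then obtain r where r: "r \<in> carrier R" "r \<noteq> \<zero>"
      "r \<odot>\<^bsub>direct_product I M\<^esub> y = \<zero>\<^bsub>direct_product I M\<^esub>"
      using tors unfolding torsion_module_def by blast
    have "r \<odot>\<^bsub>M i\<^esub> x i = \<zero>\<^bsub>M i\<^esub>" if "i \<in> K" for i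
      using fun_cong[OF r(3), of i] that K by (auto simp: direct_product_def y_def)
    with r show ?thesis by blast
  qed
  have "finite B"
  proof (rule ccontr)
    assume B: "infinite B"
    have inf: "infinite (carrier R)"
    proof
      assume fin: "finite (carrier R)"
      obtain i where i: "i \<in> B" using B by (metis finite.emptyI ex_in_conv)
      then have iI: "i \<in> I" and Mi: "module R (M i)" using M by (auto simp: B_def)
      have "x = \<zero>\<^bsub>M i\<^esub>" if x: "x \<in> carrier (M i)" for x
      proof -
        obtain r where r: "r \<in> carrier R" "r \<noteq> \<zero>" "r \<odot>\<^bsub>M i\<^esub> x = \<zero>\<^bsub>M i\<^esub>"
          using extend[of "{i}" "\<lambda>_. x"] iI x by auto
        have "inj_on (\<lambda>s. s \<otimes> r) (carrier R)"
          using r by (auto intro!: inj_onI simp: m_rcancel)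
        moreover have "(\<lambda>s. s \<otimes> r) ` carrier R \<subseteq> carrier R" using r by auto
        ultimately have "(\<lambda>s. s \<otimes> r) ` carrier R = carrier R"
          using fin by (simp add: endo_inj_surj)
        then obtain s where s: "s \<in> carrier R" "s \<otimes> r = \<one>"
          using one_closed by (metis (no_types, lifting) imageE)
        have "x = (s \<otimes> r) \<odot>\<^bsub>M i\<^esub> x"
          by (simp add: s module.smult_one[OF Mi x])
        also have "\<dots> = s \<odot>\<^bsub>M i\<^esub> (r \<odot>\<^bsub>M i\<^esub> x)"
          by (rule module.smult_assoc1[OF Mi s(1) r(1) x])
        finally show ?thesis using r(3) module.smult_r_null[OF Mi s(1)] by simp
      qed
      then have "\<one> \<in> annihilator R (M i)"
        using module.smult_one[OF Mi] by (auto simp: annihilator_def)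
      with i show False by (auto simp: B_def)
    qed
    obtain e :: "nat \<Rightarrow> 'i" where e: "inj e" "range e \<subseteq> B"
      using infinite_countable_subset[OF B] by blast
    have eB: "e n \<in> I" "module R (M (e n))" "annihilator R (M (e n)) = {\<zero>}" for n
      using e(2) M by (auto simp: B_def)
    obtain N :: "nat \<Rightarrow> ('a, 'a) module" and \<psi> where
      N: "\<And>n. module R (N n)" "\<And>n. annihilator R (N n) = {\<zero>}"
      and \<psi>: "\<And>n. inj_on (\<psi> n) (carrier (N n))"
        "\<And>n. \<psi> n ` carrier (N n) \<subseteq> carrier (M (e n))"
        "\<And>n. \<psi> n \<zero>\<^bsub>N n\<^esub> = \<zero>\<^bsub>M (e n)\<^esub>"
        "\<And>n r x. r \<in> carrier R \<Longrightarrow> x \<in> carrier (N n) \<Longrightarrow> r \<odot>\<^bsub>N n\<^esub> x \<in> carrier (N n)"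
        "\<And>n r x. r \<in> carrier R \<Longrightarrow> x \<in> carrier (N n) \<Longrightarrow>
           \<psi> n (r \<odot>\<^bsub>N n\<^esub> x) = r \<odot>\<^bsub>M (e n)\<^esub> \<psi> n x"
      using faithful_submodule_copy[OF eB(2,3) inf] by metis
    have "torsion_module R (direct_product UNIV N)"
      unfolding torsion_module_def
    proof
      fix x assume "x \<in> carrier (direct_product UNIV N)"
      then have x: "x n \<in> carrier (N n)" for n by (auto simp: direct_product_def)
      define y where "y = (\<lambda>i. \<psi> (inv_into UNIV e i) (x (inv_into UNIV e i)))"
      have ye: "y (e n) = \<psi> n (x n)" for n using e(1) by (simp add: y_def)
      have "y i \<in> carrier (M i)" if "i \<in> range e" for i
        using that \<psi>(2) x ye by force
      then obtain r where r: "r \<in> carrier R" "r \<noteq> \<zero>"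
        "\<forall>i\<in>range e. r \<odot>\<^bsub>M i\<^esub> y i = \<zero>\<^bsub>M i\<^esub>"
        using extend[of "range e" y] eB(1) by blast
      have "r \<odot>\<^bsub>N n\<^esub> x n = \<zero>\<^bsub>N n\<^esub>" for n
      proof (rule inj_onD[OF \<psi>(1)])
        show "\<psi> n (r \<odot>\<^bsub>N n\<^esub> x n) = \<psi> n \<zero>\<^bsub>N n\<^esub>"
          using r x ye \<psi>(3,5) by (metis rangeI)
        show "\<zero>\<^bsub>N n\<^esub> \<in> carrier (N n)"
          using N(1) by (intro abelian_monoid.zero_closed abelian_group.axioms(1) module.axioms(2))
      qed (use r x \<psi>(4) in auto)
      with r show "\<exists>r\<in>carrier R. r \<noteq> \<zero> \<and>
          r \<odot>\<^bsub>direct_product UNIV N\<^esub> x = \<zero>\<^bsub>direct_product UNIV N\<^esub>"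
        by (intro bexI[of _ r]) (auto simp: direct_product_def)
    qed
    then have "finite {n \<in> UNIV. annihilator R (N n) = {\<zero>}}"
      using assms N(1) unfolding weakly_productively_bounded_def by blast
    then show False using N(2) by simp
  qed
  then show "finite {i \<in> I. annihilator R (M i) = {\<zero>}}" by (simp add: B_def)
qed

end

theory Submission
  imports Defs "HOL-Algebra.QuotRing" "HOL-Library.Countable_Set" "HOL-Library.Disjoint_Sets"
begin

text \<open>Call a set of indices bounded if some nonzero ring element annihilates all the \<open>M\<^sub>i\<close> in it.
  Weak productive boundedness is used in two ways. Applied to products of the \<open>M\<^sub>i\<close> over disjoint
  index sets, it shows that no infinite sequence of disjoint sets is unbounded. Applied to modules
  built from the quotients of \<open>R\<close> by ideals, it yields a Lindeloef property: a family of ideals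
  with zero intersection has a countable subfamily with zero intersection. The latter reduces the
  theorem to a countable index set. For \<open>r \<noteq> 0\<close> let \<open>S\<^sub>r\<close> be the set of indices at which \<open>r\<close>
  does not annihilate; asking that \<open>S\<^sub>r\<close> lie in a given ideal of sets defines an ideal of \<open>R\<close>. If
  the naturals are unbounded, suitable ideals of sets violate the Lindeloef property; which ones
  depends on whether every sequence of bounded sets has a bounded pseudo-union (a set that
  contains each of them up to finitely many points), as for P-points among ultrafilters.\<close>

section \<open>Quotients by ideals as modules, and annihilators as ideals\<close>

text \<open>The fields of the quotient ring are kept in the record: \<open>one\<close> is the
  generator of the module.\<close>

definition quotient_module ::
    "('a, 'k) ring_scheme \<Rightarrow> 'a set \<Rightarrow> ('a, 'a set) module" where
  "quotient_module R J =
     \<lparr>carrier = carrier (R Quot J), monoid.mult = (\<otimes>\<^bsub>R Quot J\<^esub>), one = \<one>\<^bsub>R Quot J\<^esub>,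
      zero = \<zero>\<^bsub>R Quot J\<^esub>, add = (\<oplus>\<^bsub>R Quot J\<^esub>),
      smult = (\<lambda>r x. (J +>\<^bsub>R\<^esub> r) \<otimes>\<^bsub>R Quot J\<^esub> x)\<rparr>"

lemma (in cring) module_quotient_module:
  assumes "ideal J R"
  shows "module R (quotient_module R J)"
proof -
  interpret J: ideal J R by fact
  interpret Q: cring "R Quot J" by (rule J.quotient_is_cring[OF is_cring])
  interpret h: ring_hom_ring R "R Quot J" "(+>) J" by (rule J.rcos_ring_hom_ring)
  show ?thesis
  proof (rule moduleI)
    show "abelian_group (quotient_module R J)"
    proof (rule abelian_groupI, goal_cases)
      case (6 x)
      then show ?case
        by (intro bexI[of _ "\<ominus>\<^bsub>R Quot J\<^esub> x"]) (auto simp: quotient_module_def Q.l_neg)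
    next
      case (4 x y)
      then show ?case by (simp add: quotient_module_def Q.a_comm)
    next
      case (3 x y z)
      then show ?case by (simp add: quotient_module_def Q.a_assoc)
    qed (simp_all add: quotient_module_def)
  qed (simp_all add: quotient_module_def is_cring Q.l_distr Q.r_distr Q.m_assoc)
qed

lemma (in cring) smult_one_quotient_module:
  assumes "ideal J R" "r \<in> carrier R"
  shows "r \<odot>\<^bsub>quotient_module R J\<^esub> \<one>\<^bsub>quotient_module R J\<^esub> = \<zero>\<^bsub>quotient_module R J\<^esub> \<longleftrightarrow> r \<in> J"
proof -
  interpret J: ideal J R by fact
  interpret h: ring_hom_ring R "R Quot J" "(+>) J" by (rule J.rcos_ring_hom_ring)
  have "r \<odot>\<^bsub>quotient_module R J\<^esub> \<one>\<^bsub>quotient_module R J\<^esub> = J +> r"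
    unfolding quotient_module_def module.simps monoid.simps
    by (rule h.S.r_one) (rule h.hom_closed[OF assms(2)])
  moreover have "\<zero>\<^bsub>quotient_module R J\<^esub> = J"
    by (simp only: quotient_module_def FactRing_def module.simps ring.simps)
  moreover have "J +> r = J \<longleftrightarrow> r \<in> J"
    using J.a_rcos_const J.rcos_const_imp_mem[OF assms(2)] by blast
  ultimately show ?thesis by metis
qed

lemma (in cring) smult_quotient_module_eq_zero:
  assumes "ideal J R" "r \<in> J" "x \<in> carrier (quotient_module R J)"
  shows "r \<odot>\<^bsub>quotient_module R J\<^esub> x = \<zero>\<^bsub>quotient_module R J\<^esub>"
proof -
  interpret J: ideal J R by fact
  interpret Q: cring "R Quot J" by (rule J.quotient_is_cring[OF is_cring])
  have "J +> r = \<zero>\<^bsub>R Quot J\<^esub>"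
    using J.a_rcos_const[OF assms(2)] by (simp add: FactRing_def)
  then show ?thesis using assms(3) by (simp add: quotient_module_def)
qed

lemma (in cring) ideal_annihilator:
  assumes "module R M"
  shows "ideal (annihilator R M) R"
proof -
  interpret M: module R M by fact
  show ?thesis
  proof (rule idealI[OF ring_axioms subgroup.intro])
    fix x assume "x \<in> annihilator R M"
    then show "inv\<^bsub>add_monoid R\<^esub> x \<in> annihilator R M"
      by (simp add: annihilator_def M.smult_l_minus flip: a_inv_def)
  next
    fix a x assume "a \<in> annihilator R M" "x \<in> carrier R"
    then show "x \<otimes> a \<in> annihilator R M" "a \<otimes> x \<in> annihilator R M"
      by (simp_all add: annihilator_def M.smult_assoc1)
  qed (auto simp: annihilator_def M.smult_l_distr)
qed

section \<open>Index sets whose ideals share a nonzero element\<close>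

text \<open>Arbitrary families \<open>a\<close> are allowed, so that the notion serves both for
  annihilators of modules and for ideals indexed by sets or functions.\<close>

definition bounded_on :: "('a, 'k) ring_scheme \<Rightarrow> ('b \<Rightarrow> 'a set) \<Rightarrow> 'b set \<Rightarrow> bool" where
  "bounded_on R a A \<longleftrightarrow> (\<exists>r\<in>carrier R. r \<noteq> \<zero>\<^bsub>R\<^esub> \<and> (\<forall>n\<in>A. r \<in> a n))"

lemma bounded_on_subset: "bounded_on R a B \<Longrightarrow> A \<subseteq> B \<Longrightarrow> bounded_on R a A"
  unfolding bounded_on_def by blast

text \<open>The product of two witnesses works, being nonzero in a domain. Hence bounded sets form
  an ideal of sets.\<close>

lemma (in domain) bounded_on_Un:
  assumes a: "\<And>n. n \<in> A \<union> B \<Longrightarrow> ideal (a n) R"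
    and AB: "bounded_on R a A" "bounded_on R a B"
  shows "bounded_on R a (A \<union> B)"
proof -
  obtain r s where r: "r \<in> carrier R" "r \<noteq> \<zero>" "\<forall>n\<in>A. r \<in> a n"
    and s: "s \<in> carrier R" "s \<noteq> \<zero>" "\<forall>n\<in>B. s \<in> a n"
    using AB unfolding bounded_on_def by blast
  have "r \<otimes> s \<in> a n" if "n \<in> A \<union> B" for n
    using that a[OF that] r s by (auto intro: ideal.I_l_closed ideal.I_r_closed)
  then show ?thesis
    using r s unfolding bounded_on_def by (intro bexI[of _ "r \<otimes> s"]) (auto simp: integral_iff)
qed

lemma (in domain) bounded_on_finite_UN:
  assumes "\<And>n. n \<in> (\<Union>k\<in>K. A k) \<Longrightarrow> ideal (a n) R"
    and "finite K" "\<And>k. k \<in> K \<Longrightarrow> bounded_on R a (A k)"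
  shows "bounded_on R a (\<Union>k\<in>K. A k)"
  using assms(2,1,3)
proof (induction K)
  case empty
  then show ?case unfolding bounded_on_def by (auto intro!: bexI[of _ \<one>])
next
  case (insert k K)
  then show ?case by (auto intro!: bounded_on_Un)
qed

text \<open>The indices where \<open>x \<oplus> y\<close> fails to lie in \<open>a n\<close> are
  among those of \<open>x\<close> and those of \<open>y\<close>; passing to a multiple can only
  remove indices.\<close>

lemma (in ring) ideal_supports:
  fixes a :: "'c \<Rightarrow> 'a set"
  assumes a: "\<And>n. ideal (a n) R"
    and Z: "{} \<in> Z" "\<And>S T. S \<in> Z \<Longrightarrow> T \<subseteq> S \<Longrightarrow> T \<in> Z" "\<And>S T. S \<in> Z \<Longrightarrow> T \<in> Z \<Longrightarrow> S \<union> T \<in> Z"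
  shows "ideal {r \<in> carrier R. {n. r \<notin> a n} \<in> Z} R"
proof (rule idealI[OF ring_axioms subgroup.intro])
  note sub = additive_subgroup.a_closed[OF ideal.axioms(1)[OF a]]
    additive_subgroup.zero_closed[OF ideal.axioms(1)[OF a]]
    additive_subgroup.a_inv_closed[OF ideal.axioms(1)[OF a]]
  fix x assume x: "x \<in> {r \<in> carrier R. {n. r \<notin> a n} \<in> Z}"
  show "inv\<^bsub>add_monoid R\<^esub> x \<in> {r \<in> carrier R. {n. r \<notin> a n} \<in> Z}"
    using x sub(3) by (auto simp flip: a_inv_def intro: Z(2)[of "{n. x \<notin> a n}"])
  fix y assume y: "y \<in> {r \<in> carrier R. {n. r \<notin> a n} \<in> Z}"
  have "{n. x \<oplus> y \<notin> a n} \<subseteq> {n. x \<notin> a n} \<union> {n. y \<notin> a n}" using sub(1) by blast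
  then show "x \<otimes>\<^bsub>add_monoid R\<^esub> y \<in> {r \<in> carrier R. {n. r \<notin> a n} \<in> Z}"
    using x y by (auto intro: Z(2)[OF Z(3)])
next
  note zero = additive_subgroup.zero_closed[OF ideal.axioms(1)[OF a]]
  show "\<one>\<^bsub>add_monoid R\<^esub> \<in> {r \<in> carrier R. {n. r \<notin> a n} \<in> Z}"
    using Z(1) zero by simp
next
  fix x y assume x: "x \<in> {r \<in> carrier R. {n. r \<notin> a n} \<in> Z}" and y: "y \<in> carrier R"
  show "y \<otimes> x \<in> {r \<in> carrier R. {n. r \<notin> a n} \<in> Z}" "x \<otimes> y \<in> {r \<in> carrier R. {n. r \<notin> a n} \<in> Z}"
    using x y ideal.I_l_closed[OF a] ideal.I_r_closed[OF a]
    by (auto intro: Z(2)[of "{n. x \<notin> a n}"])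
qed auto

section \<open>The Lindeloef property and disjoint sets of indices\<close>

locale weakly_productively_bounded_domain = domain R
  for R :: "('a, 'k) ring_scheme" (structure) +
  assumes weakly_productively_bounded: "weakly_productively_bounded TYPE(nat) TYPE('a) R"
begin

text \<open>The naturals are infinite, so they cannot all be exceptional indices. The element type
  is arbitrary because the modules used below are built from products.\<close>

lemma some_annihilator_nonzero:
  fixes N :: "nat \<Rightarrow> ('a, 'm) module"
  assumes "\<And>n. module R (N n)" "torsion_module R (direct_product UNIV N)"
  shows "\<exists>n. annihilator R (N n) \<noteq> {\<zero>}"
proof (rule ccontr)
  assume "\<not> ?thesis"
  moreover have "weakly_productively_bounded TYPE(nat) TYPE('m) R"
    by (rule weakly_productively_bounded_any_type[OF weakly_productively_bounded])
  note this[unfolded weakly_productively_bounded_def, rule_format, of UNIV N]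
  then have "finite {n \<in> UNIV. annihilator R (N n) = {\<zero>}}" using assms by blast
  ultimately show False by simp
qed

text \<open>If a family of ideals has zero intersection, then the countably supported part of the
  product of the rings modulo these ideals is faithful, so its countable power is not torsion; an
  element of that power sees only countably many of the ideals.\<close>

lemma bounded_on_if_countable:
  fixes a :: "'b \<Rightarrow> 'a set"
  assumes a: "\<And>j. j \<in> F \<Longrightarrow> ideal (a j) R"
    and C: "\<And>C. C \<subseteq> F \<Longrightarrow> countable C \<Longrightarrow> bounded_on R a C"
  shows "bounded_on R a F"
proof -
  define Q where "Q j = quotient_module R (a j)" for j
  have Q: "module R (Q j)" if "j \<in> F" for j
    using module_quotient_module[OF a[OF that]] by (simp add: Q_def)
  define P where "P = direct_product F Q"
  interpret P: module R P
    unfolding P_def using Q by (intro module_direct_product is_cring)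
  define supp where "supp x = {j \<in> F. x j \<noteq> \<zero>\<^bsub>Q j\<^esub>}" for x
  define H where "H = {x \<in> carrier P. countable (supp x)}"
  have Qz: "\<zero>\<^bsub>Q j\<^esub> \<oplus>\<^bsub>Q j\<^esub> \<zero>\<^bsub>Q j\<^esub> = \<zero>\<^bsub>Q j\<^esub>" "\<And>r. r \<in> carrier R \<Longrightarrow> r \<odot>\<^bsub>Q j\<^esub> \<zero>\<^bsub>Q j\<^esub> = \<zero>\<^bsub>Q j\<^esub>"
    "\<zero>\<^bsub>Q j\<^esub> \<in> carrier (Q j)" "\<one>\<^bsub>Q j\<^esub> \<in> carrier (Q j)" if "j \<in> F" for j
  proof -
    interpret M: module R "Q j" by (rule Q[OF that])
    interpret J: ideal "a j" R by (rule a[OF that])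
    interpret Qt: ring "R Quot a j" by (rule J.quotient_is_ring)
    show "\<zero>\<^bsub>Q j\<^esub> \<oplus>\<^bsub>Q j\<^esub> \<zero>\<^bsub>Q j\<^esub> = \<zero>\<^bsub>Q j\<^esub>" "\<zero>\<^bsub>Q j\<^esub> \<in> carrier (Q j)" by simp_all
    show "\<And>r. r \<in> carrier R \<Longrightarrow> r \<odot>\<^bsub>Q j\<^esub> \<zero>\<^bsub>Q j\<^esub> = \<zero>\<^bsub>Q j\<^esub>" by simp
    show "\<one>\<^bsub>Q j\<^esub> \<in> carrier (Q j)" by (simp add: Q_def quotient_module_def)
  qed
  have smult: "r \<odot>\<^bsub>P\<^esub> x \<in> H" if r: "r \<in> carrier R" and x: "x \<in> H" for r x
  proof -
    have "supp (r \<odot>\<^bsub>P\<^esub> x) \<subseteq> supp x"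
      using Qz(2) r by (auto simp: supp_def P_def direct_product_def)
    then show ?thesis using x r by (auto simp: H_def intro: countable_subset)
  qed
  have "submodule H R P"
  proof (rule P.submoduleI)
    show "\<zero>\<^bsub>P\<^esub> \<in> H"
      using P.zero_closed by (auto simp: H_def supp_def P_def direct_product_def)
    fix x assume x: "x \<in> H"
    then show "\<ominus>\<^bsub>P\<^esub> x \<in> H"
      using smult[of "\<ominus> \<one>" x] P.smult_l_minus[of \<one> x] by (simp add: H_def)
    fix y assume y: "y \<in> H"
    have "supp (x \<oplus>\<^bsub>P\<^esub> y) \<subseteq> supp x \<union> supp y"
      using Qz(1) by (auto simp: supp_def P_def direct_product_def)
    then show "x \<oplus>\<^bsub>P\<^esub> y \<in> H"
      using x y by (auto simp: H_def intro: countable_subset)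
  qed (use smult in \<open>auto simp: H_def\<close>)
  then have N: "module R (P\<lparr>carrier := H\<rparr>)"
    by (rule submodule.submodule_is_module) (rule P.module_axioms)
  have "torsion_module R (direct_product (UNIV :: nat set) (\<lambda>_. P\<lparr>carrier := H\<rparr>))"
    unfolding torsion_module_def
  proof
    fix y assume "y \<in> carrier (direct_product (UNIV :: nat set) (\<lambda>_. P\<lparr>carrier := H\<rparr>))"
    then have y: "y n \<in> H" for n by (auto simp: direct_product_def)
    have "countable (\<Union>n. supp (y n))" using y by (auto simp: H_def)
    moreover have "(\<Union>n. supp (y n)) \<subseteq> F" by (auto simp: supp_def)
    ultimately obtain r where r: "r \<in> carrier R" "r \<noteq> \<zero>" "\<forall>j\<in>(\<Union>n. supp (y n)). r \<in> a j"
      using C unfolding bounded_on_def by meson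
    have "r \<odot>\<^bsub>Q j\<^esub> y n j = \<zero>\<^bsub>Q j\<^esub>" if j: "j \<in> F" for n j
    proof (cases "y n j = \<zero>\<^bsub>Q j\<^esub>")
      case True
      then show ?thesis using Qz(2) j r by simp
    next
      case False
      then have "r \<in> a j" using r j by (auto simp: supp_def)
      moreover have "y n j \<in> carrier (Q j)"
        using y[of n] j by (auto simp: H_def P_def direct_product_def)
      ultimately show ?thesis
        using a[OF j] by (simp add: Q_def smult_quotient_module_eq_zero)
    qed
    then have "r \<odot>\<^bsub>P\<^esub> y n = \<zero>\<^bsub>P\<^esub>" for n
      by (auto simp: P_def direct_product_def intro!: restrict_ext)
    then show "\<exists>r\<in>carrier R. r \<noteq> \<zero> \<and>
        r \<odot>\<^bsub>direct_product (UNIV :: nat set) (\<lambda>_. P\<lparr>carrier := H\<rparr>)\<^esub> y =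
          \<zero>\<^bsub>direct_product (UNIV :: nat set) (\<lambda>_. P\<lparr>carrier := H\<rparr>)\<^esub>"
      using r by (intro bexI[of _ r]) (auto simp: direct_product_def)
  qed
  \<comment> \<open>All factors are the same module, so the nonzero annihilator found is that of the
    countably supported part.\<close>
  then have "annihilator R (P\<lparr>carrier := H\<rparr>) \<noteq> {\<zero>}"
    using some_annihilator_nonzero[of "\<lambda>_. P\<lparr>carrier := H\<rparr>"] N by blast
  moreover have "\<zero> \<in> annihilator R (P\<lparr>carrier := H\<rparr>)"
    by (auto simp: annihilator_def H_def)
  ultimately obtain r where "r \<in> annihilator R (P\<lparr>carrier := H\<rparr>)" and "r \<noteq> \<zero>" by blast
  then have r: "r \<in> carrier R" "r \<noteq> \<zero>" "\<And>x. x \<in> H \<Longrightarrow> r \<odot>\<^bsub>P\<^esub> x = \<zero>\<^bsub>P\<^esub>"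
    by (auto simp: annihilator_def)
  have "r \<in> a j" if j: "j \<in> F" for j
  proof -
    \<comment> \<open>The generator placed at coordinate \<open>j\<close> has finite support;
      killing it forces \<open>r\<close> into \<open>a j\<close>.\<close>
    define x where "x = (\<lambda>i\<in>F. if i = j then \<one>\<^bsub>Q j\<^esub> else \<zero>\<^bsub>Q i\<^esub>)"
    have "x \<in> carrier P" using Qz(3,4) by (auto simp: P_def direct_product_def x_def)
    moreover have "supp x \<subseteq> {j}" by (auto simp: supp_def x_def)
    ultimately have "x \<in> H" using countable_subset[of "supp x" "{j}"] by (simp add: H_def)
    then have "r \<odot>\<^bsub>Q j\<^esub> \<one>\<^bsub>Q j\<^esub> = \<zero>\<^bsub>Q j\<^esub>"
      using fun_cong[OF r(3)[of x], of j] j by (simp add: P_def direct_product_def x_def)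
    then show ?thesis
      using smult_one_quotient_module[OF a[OF j] r(1)] by (simp add: Q_def)
  qed
  then show ?thesis using r unfolding bounded_on_def by blast
qed

text \<open>The product over \<open>n\<close> of the products over \<open>A n\<close> embeds in the
  product over \<open>I\<close> by extension with zero, hence is torsion. So one block product has a
  nonzero annihilator, which also annihilates each of its factors.\<close>

lemma disjoint_family_bounded_on:
  fixes M :: "'i \<Rightarrow> ('a, 'm) module" and A :: "nat \<Rightarrow> 'i set"
  assumes M: "\<And>i. i \<in> I \<Longrightarrow> module R (M i)"
    and tors: "torsion_module R (direct_product I M)"
    and A: "\<And>n. A n \<subseteq> I" "disjoint_family A"
  shows "\<exists>n. bounded_on R (\<lambda>i. annihilator R (M i)) (A n)"
proof -
  define N where "N n = direct_product (A n) M" for n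
  have N: "module R (N n)" for n
    unfolding N_def using A(1) M by (intro module_direct_product is_cring) auto
  have zero: "\<zero>\<^bsub>M i\<^esub> \<in> carrier (M i)" if "i \<in> I" for i
    using M[OF that] by (intro abelian_monoid.zero_closed abelian_group.axioms(1) module.axioms(2))
  have "torsion_module R (direct_product UNIV N)"
    unfolding torsion_module_def
  proof
    fix x assume "x \<in> carrier (direct_product UNIV N)"
    then have x: "x n \<in> (\<Pi>\<^sub>E i\<in>A n. carrier (M i))" for n
      by (auto simp: direct_product_def N_def)
    \<comment> \<open>Disjointness makes the block of an index unique.\<close>
    define idx where "idx i = (THE n. i \<in> A n)" for i
    have idx: "idx i = n" if "i \<in> A n" for i n
      unfolding idx_def using that A(2)
      by (intro the_equality) (auto simp: disjoint_family_on_def)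
    define y where "y = (\<lambda>i\<in>I. if \<exists>n. i \<in> A n then x (idx i) i else \<zero>\<^bsub>M i\<^esub>)"
    have "y i \<in> carrier (M i)" if "i \<in> I" for i
      using that zero x idx by (auto simp: y_def PiE_iff)
    then have "y \<in> carrier (direct_product I M)"
      by (auto simp: direct_product_def y_def)
    then obtain r where r: "r \<in> carrier R" "r \<noteq> \<zero>"
      "r \<odot>\<^bsub>direct_product I M\<^esub> y = \<zero>\<^bsub>direct_product I M\<^esub>"
      using tors unfolding torsion_module_def by blast
    have "r \<odot>\<^bsub>M i\<^esub> x n i = \<zero>\<^bsub>M i\<^esub>" if i: "i \<in> A n" for n i
    proof -
      have "i \<in> I" using i A(1) by blast
      moreover have "y i = x n i" using i idx[OF i] \<open>i \<in> I\<close> by (auto simp: y_def)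
      ultimately show ?thesis using fun_cong[OF r(3), of i] by (simp add: direct_product_def)
    qed
    then show "\<exists>r\<in>carrier R. r \<noteq> \<zero> \<and>
        r \<odot>\<^bsub>direct_product UNIV N\<^esub> x = \<zero>\<^bsub>direct_product UNIV N\<^esub>"
      using r(1,2) by (intro bexI[of _ r]) (auto simp: direct_product_def N_def intro!: restrict_ext)
  qed
  then obtain n where n: "annihilator R (N n) \<noteq> {\<zero>}"
    using some_annihilator_nonzero[of N] N by blast
  interpret Nn: module R "N n" by (rule N)
  have "\<zero> \<in> annihilator R (N n)" by (auto simp: annihilator_def)
  with n obtain r where r: "r \<in> annihilator R (N n)" "r \<noteq> \<zero>" by blast
  have "r \<in> annihilator R (M i)" if i: "i \<in> A n" for i
  proof -
    have "r \<odot>\<^bsub>M i\<^esub> z = \<zero>\<^bsub>M i\<^esub>" if z: "z \<in> carrier (M i)" for z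
    proof -
      define x where "x = (\<lambda>j\<in>A n. if j = i then z else \<zero>\<^bsub>M j\<^esub>)"
      have "x \<in> carrier (N n)"
        using zero A(1)[of n] z by (auto simp: N_def direct_product_def x_def)
      then have "r \<odot>\<^bsub>N n\<^esub> x = \<zero>\<^bsub>N n\<^esub>" using r by (auto simp: annihilator_def)
      from fun_cong[OF this, of i] show ?thesis
        using i by (simp add: N_def direct_product_def x_def)
    qed
    then show ?thesis using r by (simp add: annihilator_def)
  qed
  then show ?thesis
    using r unfolding bounded_on_def by (auto simp: annihilator_def)
qed

section \<open>Ideals indexed by the naturals\<close>

text \<open>The Lindeloef property is applied to the ideals of all \<open>r\<close> for which \<open>S\<^sub>r \<inter> A\<close> is finite, with
  \<open>A\<close> bounded: a bounded pseudo-union shows that countably many of them have a common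
  nonzero element. An \<open>r\<close> in all of them has no infinite bounded subset of \<open>S\<^sub>r\<close>, so \<open>S\<^sub>r\<close>
  is finite.\<close>

lemma bounded_on_UNIV_if_pseudo_union:
  fixes a :: "nat \<Rightarrow> 'a set"
  assumes a: "\<And>n. ideal (a n) R" and fin: "\<And>A. finite A \<Longrightarrow> bounded_on R a A"
    and disj: "\<And>A. disjoint_family A \<Longrightarrow> \<exists>n::nat. bounded_on R a (A n)"
    and pseudo: "\<And>A. (\<And>n::nat. bounded_on R a (A n)) \<Longrightarrow>
      \<exists>B. bounded_on R a B \<and> (\<forall>n. finite (A n - B))"
  shows "bounded_on R a UNIV"
proof -
  define J where "J A = {r \<in> carrier R. {n. r \<notin> a n} \<in> {S. finite (S \<inter> A)}}" for A
  have "bounded_on R J {A. bounded_on R a A}"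
  proof (rule bounded_on_if_countable)
    show "ideal (J A) R" for A
      unfolding J_def
    proof (rule ideal_supports[OF a])
      fix S T assume "S \<in> {S. finite (S \<inter> A)}" "T \<subseteq> S"
      then show "T \<in> {S. finite (S \<inter> A)}" using finite_subset[of "T \<inter> A" "S \<inter> A"] by auto
    qed (simp_all add: Int_Un_distrib2)
  next
    fix C assume C: "C \<subseteq> {A. bounded_on R a A}" "countable C"
    \<comment> \<open>Inserting \<open>{}\<close>, which is bounded, ensures that the enumerated set
      is nonempty.\<close>
    define A where "A = from_nat_into (insert {} C)"
    have rA: "range A = insert {} C"
      using C(2) by (simp add: A_def)
    have "bounded_on R a (A n)" for n
      using C(1) fin rangeI[of A n] rA by auto
    then obtain B where B: "bounded_on R a B" "\<And>n. finite (A n - B)" using pseudo by blast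
    then obtain r where r: "r \<in> carrier R" "r \<noteq> \<zero>" "\<And>n. n \<in> B \<Longrightarrow> r \<in> a n"
      unfolding bounded_on_def by blast
    have "r \<in> J D" if "D \<in> C" for D
    proof -
      have "D \<in> range A" using that by (simp add: rA)
      then obtain n where n: "D = A n" by blast
      have "{n. r \<notin> a n} \<inter> D \<subseteq> A n - B" using r(3) n by auto
      then have "finite ({n. r \<notin> a n} \<inter> D)" using B(2) by (rule finite_subset)
      then show ?thesis using r(1) by (simp add: J_def)
    qed
    then show "bounded_on R J C" using r unfolding bounded_on_def by blast
  qed
  then obtain r where r: "r \<in> carrier R" "r \<noteq> \<zero>"
    and rJ: "\<And>A. bounded_on R a A \<Longrightarrow> finite ({n. r \<notin> a n} \<inter> A)"
    unfolding bounded_on_def J_def by auto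
  define S where "S = {n. r \<notin> a n}"
  have "finite S"
  proof (rule ccontr)
    assume "infinite S"
    \<comment> \<open>Of infinitely many disjoint infinite pieces of \<open>S\<close>, one is
      bounded by \<open>disj\<close>, which contradicts \<open>rJ\<close>.\<close>
    then obtain D :: "nat \<Rightarrow> nat set" where D: "pairwise (\<lambda>i j. disjnt (D i) (D j)) UNIV"
      "\<And>i. infinite (D i)" "(\<Union>i. D i) \<subseteq> S"
      using infinite_infinite_partition by metis
    have "disjoint_family D"
      using D(1) by (auto simp: disjoint_family_on_def pairwise_def disjnt_def)
    then obtain n where "bounded_on R a (D n)" using disj by blast
    then have "finite (S \<inter> D n)" using rJ by (simp add: S_def)
    moreover have "S \<inter> D n = D n" using D(3) by blast
    ultimately show False using D(2) by simp
  qed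
  moreover have "bounded_on R a (- S)" using r unfolding bounded_on_def S_def by blast
  ultimately have "bounded_on R a (S \<union> - S)" using fin a by (intro bounded_on_Un)
  then show ?thesis by simp
qed

text \<open>With \<open>B\<close> the disjointed sequence, \<open>X h\<close> is the part of its union below the graph of \<open>h\<close>. As
  disjoint unbounded sets run out, some \<open>X h0\<close> absorbs every \<open>X h\<close> up to a bounded set. The
  Lindeloef property is applied to the ideals of all \<open>r\<close> for which \<open>S\<^sub>r\<close> meets \<open>X h - X h0\<close> in only
  finitely many \<open>B n\<close>; countably many \<open>h\<close> are eventually dominated by a single one.\<close>

lemma pseudo_union_exists:
  fixes a :: "nat \<Rightarrow> 'a set" and A :: "nat \<Rightarrow> nat set"
  assumes a: "\<And>n. ideal (a n) R"
    and disj: "\<And>A. disjoint_family A \<Longrightarrow> \<exists>n::nat. bounded_on R a (A n)"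
    and A: "\<And>n. bounded_on R a (A n)"
  shows "\<exists>B. bounded_on R a B \<and> (\<forall>n. finite (A n - B))"
proof -
  define B where "B = disjointed A"
  have BA: "B n \<subseteq> A n" for n by (simp add: B_def disjointed_subset)
  define X where "X h = (\<Union>n. B n \<inter> {..h n})" for h :: "nat \<Rightarrow> nat"
  have X_mono: "X g \<subseteq> X h" if "\<And>n. g n \<le> h n" for g h
    using that unfolding X_def by (fastforce intro: order_trans)
  obtain h0 where h0: "\<And>h. bounded_on R a (X h - X h0)"
  proof (rule ccontr)
    assume "\<not> thesis"
    then have "\<forall>g. \<exists>h. \<not> bounded_on R a (X h - X g)" using that by blast
    then obtain f where f: "\<And>g. \<not> bounded_on R a (X (f g) - X g)" by metis
    \<comment> \<open>Each stage raises the bound \<open>g\<close> so that \<open>X\<close> gains at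
      least the unbounded set \<open>X (f g) - X g\<close>; the successive gains \<open>D k\<close>
      are disjoint.\<close>
    define H where "H = rec_nat (\<lambda>_. 0) (\<lambda>_ g n. max (g n) (f g n))"
    have HS: "H (Suc k) = (\<lambda>n. max (H k n) (f (H k) n))" for k by (simp add: H_def)
    define D where "D k = X (H (Suc k)) - X (H k)" for k
    have mono: "X (H k) \<subseteq> X (H l)" if "k \<le> l" for k l
      by (rule lift_Suc_mono_le[of "\<lambda>k. X (H k)", OF _ that]) (rule X_mono, simp add: HS)
    have "D k \<inter> D l = {}" if "k < l" for k l
      using mono[of "Suc k" l] that by (auto simp: D_def)
    then have "disjoint_family D"
      unfolding disjoint_family_on_def by (metis inf_commute linorder_neqE_nat)
    then obtain k where k: "bounded_on R a (D k)" using disj by blast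
    have "X (f (H k)) \<subseteq> X (H (Suc k))" by (rule X_mono) (simp add: HS)
    then have "bounded_on R a (X (f (H k)) - X (H k))"
      using k by (auto simp: D_def intro: bounded_on_subset)
    then show False using f by blast
  qed
  define J where "J h = {r \<in> carrier R.
    {n. r \<notin> a n} \<in> {S. finite {n. S \<inter> (B n \<inter> {..h n} - X h0) \<noteq> {}}}}" for h
  have "bounded_on R J UNIV"
  proof (rule bounded_on_if_countable)
    show "ideal (J h) R" for h
      unfolding J_def
    proof (rule ideal_supports[OF a])
      fix S T assume S: "S \<in> {S. finite {n. S \<inter> (B n \<inter> {..h n} - X h0) \<noteq> {}}}"
      show "T \<in> {S. finite {n. S \<inter> (B n \<inter> {..h n} - X h0) \<noteq> {}}}" if "T \<subseteq> S"
        using S that by (auto elim!: rev_finite_subset)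
      assume T: "T \<in> {S. finite {n. S \<inter> (B n \<inter> {..h n} - X h0) \<noteq> {}}}"
      have "{n. (S \<union> T) \<inter> (B n \<inter> {..h n} - X h0) \<noteq> {}} =
          {n. S \<inter> (B n \<inter> {..h n} - X h0) \<noteq> {}} \<union> {n. T \<inter> (B n \<inter> {..h n} - X h0) \<noteq> {}}"
        by blast
      then show "S \<union> T \<in> {S. finite {n. S \<inter> (B n \<inter> {..h n} - X h0) \<noteq> {}}}"
        using S T by simp
    qed simp
  next
    fix C :: "(nat \<Rightarrow> nat) set" assume C: "countable C"
    define g where "g = from_nat_into (insert (\<lambda>_. 0) C)"
    have rg: "range g = insert (\<lambda>_. 0) C" using C by (simp add: g_def)
    \<comment> \<open>The maximum runs over \<open>k \<le> n\<close>, so \<open>h\<close> dominates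
      \<open>g k\<close> from position \<open>k\<close> on.\<close>
    define h where "h n = Max ((\<lambda>k. g k n) ` {..n})" for n
    have gh: "g k n \<le> h n" if "k \<le> n" for k n
      unfolding h_def using that by (intro Max_ge) auto
    obtain r where r: "r \<in> carrier R" "r \<noteq> \<zero>" "\<And>n. n \<in> X h - X h0 \<Longrightarrow> r \<in> a n"
      using h0[of h] unfolding bounded_on_def by blast
    have "r \<in> J c" if "c \<in> C" for c
    proof -
      have "c \<in> range g" using that by (simp add: rg)
      then obtain k where k: "c = g k" by blast
      have "{n. {n. r \<notin> a n} \<inter> (B n \<inter> {..c n} - X h0) \<noteq> {}} \<subseteq> {..<k}"
      proof (rule subsetI, rule ccontr)
        fix n assume n: "n \<in> {n. {n. r \<notin> a n} \<inter> (B n \<inter> {..c n} - X h0) \<noteq> {}}" "n \<notin> {..<k}"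
        then obtain m where m: "r \<notin> a m" "m \<in> B n" "m \<le> g k n" "m \<notin> X h0" using k by blast
        have "m \<le> h n" using m(3) gh[of k n] n(2) by simp
        then have "m \<in> X h" using m(2) by (auto simp: X_def)
        then show False using r(3) m by blast
      qed
      then have "finite {n. {n. r \<notin> a n} \<inter> (B n \<inter> {..c n} - X h0) \<noteq> {}}"
        by (rule finite_subset) simp
      then show ?thesis using r(1) by (simp add: J_def)
    qed
    then show "bounded_on R J C" using r unfolding bounded_on_def by blast
  qed
  then obtain r where r: "r \<in> carrier R" "r \<noteq> \<zero>"
    and rJ: "\<And>h. finite {n. {n. r \<notin> a n} \<inter> (B n \<inter> {..h n} - X h0) \<noteq> {}}"
    unfolding bounded_on_def J_def by auto
  define S where "S = {n. r \<notin> a n}"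
  \<comment> \<open>The least point is reached whenever \<open>S \<inter> (B n - X h0)\<close> is
    nonempty, so for this \<open>h\<close> the finiteness in \<open>rJ\<close> extends from the
    truncated sets to the whole \<open>B n\<close>.\<close>
  define h where "h n = (LEAST m. m \<in> S \<inter> (B n - X h0))" for n
  have "{n. S \<inter> (B n - X h0) \<noteq> {}} \<subseteq> {n. S \<inter> (B n \<inter> {..h n} - X h0) \<noteq> {}}"
  proof
    fix n assume "n \<in> {n. S \<inter> (B n - X h0) \<noteq> {}}"
    then have "h n \<in> S \<inter> (B n - X h0)"
      unfolding h_def by (metis (mono_tags, lifting) LeastI_ex ex_in_conv mem_Collect_eq)
    then show "n \<in> {n. S \<inter> (B n \<inter> {..h n} - X h0) \<noteq> {}}" by blast
  qed
  then have finS: "finite {n. S \<inter> (B n - X h0) \<noteq> {}}" (is "finite ?K")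
    using rJ[of h] unfolding S_def by (rule finite_subset)
  \<comment> \<open>This is the pseudo-union. It is bounded because, apart from the finitely many
    \<open>A n\<close> with \<open>n\<close> in \<open>?K\<close>, it lies outside \<open>S\<close>,
    where \<open>r\<close> belongs to every ideal.\<close>
  define Y where "Y = (\<Union>n. A n) - X h0"
  have "bounded_on R a ((\<Union>n\<in>?K. A n) \<union> - S)"
    using r finS A a by (intro bounded_on_Un bounded_on_finite_UN) (auto simp: bounded_on_def S_def)
  moreover have "Y \<subseteq> (\<Union>n\<in>?K. A n) \<union> - S"
  proof
    fix y assume y: "y \<in> Y"
    then obtain n where "y \<in> B n" unfolding Y_def B_def by (metis DiffD1 UN_E UN_disjointed_eq)
    with y BA show "y \<in> (\<Union>n\<in>?K. A n) \<union> - S" unfolding Y_def by blast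
  qed
  ultimately have "bounded_on R a Y" by (rule bounded_on_subset)
  moreover have "finite (A n - Y)" for n
  proof -
    have "A n - Y \<subseteq> (\<Union>m\<in>{..n}. {..h0 m})"
    proof
      fix x assume "x \<in> A n - Y"
      then have x: "x \<in> A n" "x \<in> X h0" by (auto simp: Y_def)
      then obtain m where m: "x \<in> B m" "x \<le> h0 m" by (auto simp: X_def)
      \<comment> \<open>\<open>B m\<close> omits every \<open>A i\<close> with \<open>i < m\<close>,
        so only finitely many bounds \<open>h0 m\<close> matter for \<open>A n\<close>.\<close>
      have "m \<le> n" using m(1) x(1) by (auto simp: B_def disjointed_def not_less[symmetric])
      with m show "x \<in> (\<Union>m\<in>{..n}. {..h0 m})" by auto
    qed
    then show ?thesis by (rule finite_subset) auto
  qed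
  ultimately show ?thesis by blast
qed

lemma bounded_on_UNIV:
  fixes a :: "nat \<Rightarrow> 'a set"
  assumes "\<And>n. ideal (a n) R" "\<And>A. finite A \<Longrightarrow> bounded_on R a A"
    and "\<And>A. disjoint_family A \<Longrightarrow> \<exists>n::nat. bounded_on R a (A n)"
  shows "bounded_on R a UNIV"
  using bounded_on_UNIV_if_pseudo_union[OF assms pseudo_union_exists[OF assms(1,3)]] by blast

end

section \<open>Passage to arbitrary families of modules\<close>

theorem theorem4:
  fixes R :: "('a, 'k) ring_scheme"
  assumes "domain R"
    and "weakly_productively_bounded TYPE(nat) TYPE('a) R"
  shows "productively_bounded TYPE('i) TYPE('m) R"
  unfolding productively_bounded_def
proof (intro allI impI)
  fix I :: "'i set" and M :: "'i \<Rightarrow> ('a, 'm) module"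
  assume "\<forall>i\<in>I. module R (M i) \<and> torsion_module R (M i)"
  then have M: "\<And>i. i \<in> I \<Longrightarrow> module R (M i)" by blast
  assume tors: "torsion_module R (direct_product I M)"
  interpret weakly_productively_bounded_domain R
    using assms by (simp add: weakly_productively_bounded_domain_def
      weakly_productively_bounded_domain_axioms_def)
  define b where "b i = annihilator R (M i)" for i
  have b: "ideal (b i) R" if "i \<in> I" for i
    unfolding b_def by (rule ideal_annihilator[OF M[OF that]])
  \<comment> \<open>Discarding the finitely many indices with zero annihilator makes every
    singleton, hence every finite set, bounded.\<close>
  define I0 where "I0 = {i \<in> I. b i \<noteq> {\<zero>\<^bsub>R\<^esub>}}"
  have "weakly_productively_bounded TYPE('i) TYPE('m) R"
    by (rule weakly_productively_bounded_any_type[OF assms(2)])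
  then have "finite {i \<in> I. annihilator R (M i) = {\<zero>\<^bsub>R\<^esub>}}"
    using M tors unfolding weakly_productively_bounded_def by blast
  moreover have "I - I0 = {i \<in> I. annihilator R (M i) = {\<zero>\<^bsub>R\<^esub>}}"
    by (auto simp: I0_def b_def)
  ultimately have cofin: "finite (I - I0)" by simp
  have sub: "I0 \<subseteq> I" by (auto simp: I0_def)
  have single: "bounded_on R b {i}" if i: "i \<in> I0" for i
  proof -
    interpret i: ideal "b i" R using b i sub by blast
    have "b i \<noteq> {\<zero>\<^bsub>R\<^esub>}" using i by (simp add: I0_def)
    then obtain r where "r \<in> b i" "r \<noteq> \<zero>\<^bsub>R\<^esub>" using i.zero_closed by blast
    then show ?thesis unfolding bounded_on_def using i.Icarr by blast
  qed
  have fin: "bounded_on R b A" if "finite A" "A \<subseteq> I0" for A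
    using bounded_on_finite_UN[of "\<lambda>i. {i}" A b] that b single sub by auto
  have "bounded_on R b I0"
  \<comment> \<open>It suffices to bound countable subsets of \<open>I0\<close>; infinite ones are
    enumerated injectively by \<open>e\<close> and treated as families over the naturals.\<close>
  proof (rule bounded_on_if_countable)
    fix C assume C: "C \<subseteq> I0" "countable C"
    show "bounded_on R b C"
    proof (cases "finite C")
      case True
      then show ?thesis using C(1) by (rule fin)
    next
      case False
      define e where "e = from_nat_into C"
      have e: "bij_betw e UNIV C"
        unfolding e_def using C(2) False by (rule bij_betw_from_nat_into)
      have eI: "e n \<in> I0" for n using e C(1) by (auto simp: bij_betw_def)
      have transfer: "bounded_on R (b \<circ> e) A \<longleftrightarrow> bounded_on R b (e ` A)" for A
        by (simp add: bounded_on_def)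
      have "bounded_on R (b \<circ> e) UNIV"
      proof (rule bounded_on_UNIV)
        show "ideal ((b \<circ> e) n) R" for n using b eI sub by auto
        show "bounded_on R (b \<circ> e) A" if "finite A" for A
          unfolding transfer using that eI by (intro fin) auto
        fix A :: "nat \<Rightarrow> nat set" assume A: "disjoint_family A"
        have "disjoint_family (\<lambda>n. e ` A n)"
          using A e by (auto simp: disjoint_family_on_def bij_betw_def dest: injD)
        then show "\<exists>n. bounded_on R (b \<circ> e) (A n)"
          unfolding transfer b_def using eI sub
          by (intro disjoint_family_bounded_on[OF M tors]) auto
      qed
      then show ?thesis using e by (simp add: transfer bij_betw_def)
    qed
  qed (use b sub in blast)
  then obtain r where "r \<in> carrier R" "r \<noteq> \<zero>\<^bsub>R\<^esub>" "\<forall>i\<in>I0. r \<in> b i"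
    unfolding bounded_on_def by blast
  then have "carrier R \<inter> (\<Inter>i\<in>I0. annihilator R (M i)) \<noteq> {\<zero>\<^bsub>R\<^esub>}" unfolding b_def by blast
  then show "\<exists>J\<subseteq>I. finite (I - J) \<and>
      carrier R \<inter> (\<Inter>i\<in>J. annihilator R (M i)) \<noteq> {\<zero>\<^bsub>R\<^esub>}"
    using sub cofin by blast
qed

end
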